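(* Let $k$ be a field of characteristic $2$, let $s,t$ be algebraically independent over $k$, and let $\mathfrak G(x)=x^2+sx+t$. Then $$\lim_{n\to\infty}\mathrm{FPP}\big(\operatorname{Gal}(\mathfrak G^n(x)/k(s,t))\big)=\frac13.$$
   Context: $\mathfrak G^n$ is $n$-fold composition; $\operatorname{Gal}(\mathfrak G^n(x)/k(s,t))$ is the Galois group of its splitting field over $k(s,t)$, acting on the roots of $\mathfrak G^n(x)$. For such a group $G$, $\mathrm{FPP}(G)$ is the proportion of elements of $G$ that fix at least one root of $\mathfrak G^n(x)$. *)

theory Defs
  imports "HOL-Algebra.Algebraic_Closure_Type" "HOL-Computational_Algebra.Fraction_Field"
begin

text \<open>The rational function field k(s,t) in two algebraically independent
  variables is modelled as the fraction field of k[s][t] = k poly poly.\<close>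

type_synonym 'k rfun2 = "'k poly poly fract"

definition var_s :: "'k::field rfun2" where
  "var_s = Fract [:[:0, 1:]:] 1"

definition var_t :: "'k::field rfun2" where
  "var_t = Fract [:0, 1:] 1"

definition frakG :: "'k::field rfun2 poly" where
  "frakG = [:var_t, var_s, 1:]"

definition frakG_iter :: "nat \<Rightarrow> 'k::field rfun2 poly" where
  "frakG_iter n = ((\<lambda>p. pcompose frakG p) ^^ n) [:0, 1:]"

definition iter_roots :: "nat \<Rightarrow> 'k::field rfun2 alg_closure set" where
  "iter_roots n = {r. poly (map_poly to_ac (frakG_iter n)) r = 0}"

definition base_autos :: "('a::field alg_closure \<Rightarrow> 'a alg_closure) set" where
  "base_autos = {\<sigma>. bij \<sigma> \<and> (\<forall>x y. \<sigma> (x + y) = \<sigma> x + \<sigma> y) \<and>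
      (\<forall>x y. \<sigma> (x * y) = \<sigma> x * \<sigma> y) \<and> (\<forall>a. \<sigma> (to_ac a) = to_ac a)}"

text \<open>Galois group of the splitting field of G^n over k(s,t), as a permutation
  group on the roots of G^n: restrictions of base-fixing automorphisms of the
  algebraic closure (these are exactly the automorphisms of the splitting field).\<close>
definition Gal_iter :: "nat \<Rightarrow> ('k::field rfun2 alg_closure \<Rightarrow> 'k rfun2 alg_closure) set" where
  "Gal_iter n = (\<lambda>\<sigma>. restrict \<sigma> (iter_roots n)) ` base_autos"

definition FPP :: "('a \<Rightarrow> 'a) set \<Rightarrow> 'a set \<Rightarrow> real" where
  "FPP G R = real (card {g \<in> G. \<exists>r \<in> R. g r = r}) / real (card G)"

end

theory Submission
  imports Defs "Berlekamp_Zassenhaus.Unique_Factorization_Poly"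
begin

text \<open>In characteristic 2 the map \<open>G(x) = L(x) + t\<close> is affine over the additive map
  \<open>L(x) = x\<^sup>2 + s x\<close>. The roots of \<open>G\<^sup>n\<close> form a torsor under \<open>W n = ker L\<^sup>n\<close>, a free module of
  rank one over \<open>R = F\<^sub>2[z]/(z\<^sup>n)\<close>, with \<open>z\<close> acting as \<open>L\<close>, so that the Galois group embeds into
  the maps \<open>x \<mapsto> u x + b\<close> with \<open>u \<in> 1 + z R\<close> and \<open>b \<in> R\<close>. It is everything: the generators of
  \<open>W n\<close> are the roots of \<open>L\<^bsup>n-1\<^esup>(x) + s\<close>, which is Eisenstein at \<open>s\<close>, and this remains so over
  \<open>k(s, v)\<close> for a root \<open>v\<close> of \<open>G\<close>; as \<open>v\<close> is not in \<open>k(s, t)\<close>, some automorphism fixes \<open>W n\<close> and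
  moves \<open>v\<close>, and it generates all translations as a module. Finally \<open>x \<mapsto> u x + b\<close> has a fixed
  point iff \<open>b\<close> lies in the submodule generated by \<open>u - 1\<close>, and counting such pairs gives the
  proportion \<open>1/3 + 1/(6 \<cdot> 4\<^bsup>n-1\<^esup>)\<close>.\<close>

section \<open>Homomorphisms on the algebraic closure\<close>

interpretation to_ac: field_hom to_ac
  by unfold_locales simp_all

lemma field_hom_comp:
  assumes "field_hom f" "field_hom g"
  shows "field_hom (f \<circ> g)"
proof -
  interpret f: field_hom f by fact
  interpret g: field_hom g by fact
  show ?thesis by unfold_locales (simp_all add: f.hom_add f.hom_mult g.hom_add g.hom_mult)
qed

lemma field_hom_inv_into:
  assumes "field_hom h" "bij h"
  shows "field_hom (inv_into UNIV h)"
proof -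
  interpret field_isom h
    using assms by (simp add: field_isom_def surjective_def bij_is_surj)
  show ?thesis by (rule inv.field_hom_axioms)
qed

lemma irreducible_dvd_of_common_root:
  fixes p q :: "'a::field poly" and h :: "'a \<Rightarrow> 'b::field"
  assumes "field_hom h" "irreducible p"
    and root: "poly (map_poly h p) x = 0" "poly (map_poly h q) x = 0"
  shows "p dvd q"
proof -
  interpret field_hom h by fact
  interpret poly_hom: map_poly_comm_ring_hom h by unfold_locales
  have "p \<noteq> 0" using \<open>irreducible p\<close> by auto
  then obtain m where m: "m \<noteq> 0" "poly (map_poly h m) x = 0"
    and minimal: "\<And>f. f \<noteq> 0 \<Longrightarrow> poly (map_poly h f) x = 0 \<Longrightarrow> degree m \<le> degree f"
    using ex_has_least_nat[of "\<lambda>f. f \<noteq> 0 \<and> poly (map_poly h f) x = 0" p degree] root(1) by blast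
  have m_dvd: "m dvd f" if "poly (map_poly h f) x = 0" for f
  proof -
    have "poly (map_poly h (f div m * m + f mod m)) x = 0" using that by simp
    then have "poly (map_poly h (f mod m)) x = 0"
      unfolding poly_hom.hom_add poly_hom.hom_mult using m(2) by simp
    then have "f mod m = 0"
      using minimal[of "f mod m"] degree_mod_less[OF m(1), of f] by linarith
    then show ?thesis by (simp add: dvd_eq_mod_eq_0)
  qed
  have "\<not> is_unit m"
  proof
    assume "is_unit m"
    then obtain c where "m = [:c:]" by (rule is_unit_polyE)
    then show False using m by simp
  qed
  then have "p dvd m"
    using irreducibleD'[OF \<open>irreducible p\<close> m_dvd[OF root(1)]] by blast
  with m_dvd[OF root(2)] show ?thesis by (rule dvd_trans[rotated])
qed

definition cancel_leading_term :: "'a::field poly \<Rightarrow> 'a poly \<Rightarrow> 'a poly" where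
  "cancel_leading_term f p =
    f - monom (lead_coeff f * inverse (lead_coeff p)) (degree f - degree p) * p"

lemma degree_cancel_leading_term:
  assumes "p \<noteq> 0" "degree p \<le> degree f" "degree f > 0"
  shows "degree (cancel_leading_term f p) < degree f"
proof (rule degree_lessI)
  show "cancel_leading_term f p \<noteq> 0 \<or> 0 < degree f" using assms by blast
  show "\<forall>k\<ge>degree f. coeff (cancel_leading_term f p) k = 0"
  proof (intro allI impI)
    fix k assume "degree f \<le> k"
    then consider "k = degree f" | "k > degree f" by linarith
    then show "coeff (cancel_leading_term f p) k = 0"
      using assms by cases (simp_all add: cancel_leading_term_def coeff_monom_mult coeff_eq_0)
  qed
qed

lemma mod_cancel_leading_term: "cancel_leading_term f p mod p = f mod p"
  by (simp add: cancel_leading_term_def poly_mod_diff_left)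

text \<open>A homomorphism from a subring of the algebraic closure is represented by its graph, so that
  the union of a chain of extensions is a plain set union.\<close>

locale partial_hom = field_hom \<psi>
  for \<psi> :: "'a::field \<Rightarrow> 'b::field" and M :: "('a alg_closure \<times> 'b) set" +
  assumes extends: "(to_ac a, \<psi> a) \<in> M"
    and add_mem: "(x, y) \<in> M \<Longrightarrow> (x', y') \<in> M \<Longrightarrow> (x + x', y + y') \<in> M"
    and mult_mem: "(x, y) \<in> M \<Longrightarrow> (x', y') \<in> M \<Longrightarrow> (x * x', y * y') \<in> M"
    and single_valued: "(x, y) \<in> M \<Longrightarrow> (x, y') \<in> M \<Longrightarrow> y = y'"

definition poly_rel :: "('a::zero \<times> 'b::zero) set \<Rightarrow> 'a poly \<Rightarrow> 'b poly \<Rightarrow> bool" where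
  "poly_rel M p q \<longleftrightarrow> (\<forall>i. (coeff p i, coeff q i) \<in> M)"

context partial_hom
begin

lemma zero_mem: "(0, 0) \<in> M" and one_mem: "(1, 1) \<in> M"
  using extends[of 0] extends[of 1] by auto

lemma uminus_mem: "(x, y) \<in> M \<Longrightarrow> (- x, - y) \<in> M"
  using mult_mem[OF extends[of "- 1"]] by (fastforce simp: hom_uminus)

lemma sum_mem: "(\<And>i. i \<in> I \<Longrightarrow> (f i, g i) \<in> M) \<Longrightarrow> (sum f I, sum g I) \<in> M"
  by (induction I rule: infinite_finite_induct) (auto intro: zero_mem add_mem)

lemma poly_rel_add: "poly_rel M f g \<Longrightarrow> poly_rel M f' g' \<Longrightarrow> poly_rel M (f + f') (g + g')"
  by (simp add: poly_rel_def add_mem)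

lemma poly_rel_diff: "poly_rel M f g \<Longrightarrow> poly_rel M f' g' \<Longrightarrow> poly_rel M (f - f') (g - g')"
  unfolding diff_conv_add_uminus poly_rel_def
  by (simp add: add_mem uminus_mem del: add_uminus_conv_diff)

lemma poly_rel_mult: "poly_rel M f g \<Longrightarrow> poly_rel M f' g' \<Longrightarrow> poly_rel M (f * f') (g * g')"
  by (auto simp: poly_rel_def coeff_mult intro!: sum_mem mult_mem)

lemma poly_rel_monom: "(x, y) \<in> M \<Longrightarrow> poly_rel M (monom x n) (monom y n)"
  by (simp add: poly_rel_def zero_mem)

lemma poly_rel_map_poly: "poly_rel M (map_poly to_ac p) (map_poly \<psi> p)"
  by (simp add: poly_rel_def extends)

lemma poly_rel_poly:
  assumes "poly_rel M f g" "(x, y) \<in> M"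
  shows "(poly f x, poly g y) \<in> M"
  using assms(1)
proof (induction f arbitrary: g)
  case 0
  then have "coeff g i = 0" for i
    using single_valued zero_mem by (auto simp: poly_rel_def)
  then have "g = 0" by (simp add: poly_eq_iff)
  then show ?case by (simp add: zero_mem)
next
  case (pCons a f)
  obtain b g' where g: "g = pCons b g'" by (cases g)
  have "(a, b) \<in> M" "poly_rel M f g'"
    using pCons.prems unfolding poly_rel_def g by (metis coeff_pCons_0, metis coeff_pCons_Suc)
  then show ?case
    using pCons.IH[of g'] \<open>(x, y) \<in> M\<close> by (simp add: g add_mem mult_mem)
qed

text \<open>No closure under inverses is assumed: an algebraic \<open>x \<noteq> 0\<close> has its inverse in the ring that it
  generates over the base field.\<close>

lemma inverse_in_domain:
  assumes "(x, y) \<in> M" "x \<noteq> 0"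
  obtains z where "(inverse x, z) \<in> M"
proof -
  obtain p :: "'a poly" where "p \<noteq> 0" "poly (map_poly to_ac p) x = 0"
    by (rule alg_closure_algebraic)
  then have "\<exists>z. (inverse x, z) \<in> M"
  proof (induction p)
    case (pCons a p)
    let ?P = "poly (map_poly to_ac p) x"
    have root: "to_ac a + x * ?P = 0"
      using pCons.prems by (simp add: map_poly_pCons)
    show ?case
    proof (cases "a = 0")
      case True
      then show ?thesis using pCons root \<open>x \<noteq> 0\<close> by simp
    next
      case False
      have "x * ?P = - to_ac a" using root by (simp add: add_eq_0_iff)
      then have "x * (?P * to_ac (inverse (- a))) = 1"
        using False by (simp add: mult.assoc[symmetric])
      then have "inverse x = ?P * to_ac (inverse (- a))"
        by (rule inverse_unique)
      then show ?thesis
        using mult_mem[OF poly_rel_poly[OF poly_rel_map_poly \<open>(x, y) \<in> M\<close>] extends] by metis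
    qed
  qed simp
  then show thesis using that by blast
qed

lemma
  assumes xy: "(x, y) \<in> M"
  shows inverse_mem: "(inverse x, inverse y) \<in> M" and eq_0_iff: "y = 0 \<longleftrightarrow> x = 0"
proof -
  have "(inverse x, inverse y) \<in> M \<and> y \<noteq> 0" if "x \<noteq> 0"
  proof -
    obtain z where z: "(inverse x, z) \<in> M" using inverse_in_domain[OF xy \<open>x \<noteq> 0\<close>] .
    then have "(1, y * z) \<in> M" using mult_mem[OF xy z] \<open>x \<noteq> 0\<close> by simp
    then have "y * z = 1" using one_mem single_valued by blast
    then have "inverse y = z" "y \<noteq> 0" using inverse_unique by auto
    then show ?thesis using z by simp
  qed
  moreover have "y = 0" if "x = 0" using single_valued zero_mem xy that by blast
  ultimately show "(inverse x, inverse y) \<in> M" "y = 0 \<longleftrightarrow> x = 0"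
    using zero_mem by (cases "x = 0"; simp)+
qed

lemma poly_rel_eq_0_iff: "poly_rel M f g \<Longrightarrow> g = 0 \<longleftrightarrow> f = 0"
  using eq_0_iff by (auto simp: poly_rel_def poly_eq_iff)

lemma poly_rel_degree: "poly_rel M f g \<Longrightarrow> degree g = degree f"
  using eq_0_iff unfolding poly_rel_def degree_def by meson

lemma poly_rel_cancel_leading_term:
  assumes fg: "poly_rel M f g" and pq: "poly_rel M p q"
  shows "poly_rel M (cancel_leading_term f p) (cancel_leading_term g q)"
proof -
  have "(lead_coeff f, lead_coeff g) \<in> M" "(lead_coeff p, lead_coeff q) \<in> M"
    using fg pq by (simp_all add: poly_rel_def poly_rel_degree[OF fg] poly_rel_degree[OF pq])
  then show ?thesis
    unfolding cancel_leading_term_def poly_rel_degree[OF fg] poly_rel_degree[OF pq]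
    by (intro poly_rel_diff poly_rel_mult poly_rel_monom mult_mem inverse_mem fg pq)
qed

lemma poly_rel_mod:
  assumes "poly_rel M f g" and pq: "poly_rel M p q"
  shows "poly_rel M (f mod p) (g mod q)"
  using assms(1)
proof (induction "degree f" arbitrary: f g rule: less_induct)
  case less
  note degrees = poly_rel_degree[OF less.prems] poly_rel_degree[OF pq]
  consider (zero) "p = 0" | (smaller) "degree f < degree p"
    | (constants) "p \<noteq> 0" "degree f = 0" "degree p = 0"
    | (reducible) "p \<noteq> 0" "degree p \<le> degree f" "degree f > 0"
    by linarith
  then show ?case
  proof cases
    case zero
    then show ?thesis using poly_rel_eq_0_iff[OF pq] less.prems by simp
  next
    case smaller
    then show ?thesis using degrees less.prems by (simp add: mod_poly_less)
  next
    case constants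
    then have "f mod p = 0" "g mod q = 0"
      using degrees poly_rel_eq_0_iff[OF pq] degree_mod_less[of p f] degree_mod_less[of q g] by auto
    then show ?thesis by (simp add: poly_rel_def zero_mem)
  next
    case reducible
    then have "degree (cancel_leading_term f p) < degree f" by (intro degree_cancel_leading_term)
    then have "poly_rel M (cancel_leading_term f p mod p) (cancel_leading_term g q mod q)"
      using poly_rel_cancel_leading_term[OF less.prems pq] by (rule less.hyps)
    then show ?thesis by (simp only: mod_cancel_leading_term)
  qed
qed

lemma adjoin:
  assumes root: "\<And>f g. poly_rel M f g \<Longrightarrow> poly f a = 0 \<Longrightarrow> poly g b = 0"
  obtains M' where "partial_hom \<psi> M'" "M \<subseteq> M'" "(a, b) \<in> M'"
proof
  define M' where "M' = {(poly f a, poly g b) | f g. poly_rel M f g}"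
  have M'I: "(poly f a, poly g b) \<in> M'" if "poly_rel M f g" for f g
    using that by (auto simp: M'_def)
  show sub: "M \<subseteq> M'"
    using M'I[OF poly_rel_monom[where n = 0]] by (auto simp: monom_0)
  show "(a, b) \<in> M'"
    using M'I[OF poly_rel_monom[OF one_mem, of 1]] by (simp add: poly_monom)
  show "partial_hom \<psi> M'"
  proof unfold_locales
    show "(to_ac c, \<psi> c) \<in> M'" for c using extends sub by auto
  next
    fix x y x' y' assume "(x, y) \<in> M'" "(x', y') \<in> M'"
    then obtain f g f' g' where rel: "poly_rel M f g" "poly_rel M f' g'"
      and "x = poly f a" "y = poly g b" "x' = poly f' a" "y' = poly g' b"
      by (auto simp: M'_def)
    then show "(x + x', y + y') \<in> M'" "(x * x', y * y') \<in> M'"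
      using M'I[OF poly_rel_add[OF rel]] M'I[OF poly_rel_mult[OF rel]] by simp_all
  next
    fix x y y' assume "(x, y) \<in> M'" "(x, y') \<in> M'"
    then obtain f g f' g' where rel: "poly_rel M f g" "poly_rel M f' g'"
      and "x = poly f a" "y = poly g b" "x = poly f' a" "y' = poly g' b"
      by (auto simp: M'_def)
    then show "y = y'" using root[OF poly_rel_diff[OF rel]] by simp
  qed
qed

end

lemma partial_hom_extend_to_element:
  fixes \<psi> :: "'a::field \<Rightarrow> 'b::alg_closed_field"
  assumes "partial_hom \<psi> M"
  obtains b M' where "partial_hom \<psi> M'" "M \<subseteq> M'" "(a, b) \<in> M'"
proof -
  interpret partial_hom \<psi> M by fact
  let ?vanishing = "\<lambda>p. p \<noteq> 0 \<and> poly p a = 0 \<and> (\<exists>q. poly_rel M p q)"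
  obtain c :: "'a poly" where "c \<noteq> 0" "poly (map_poly to_ac c) a = 0"
    by (rule alg_closure_algebraic)
  then have "?vanishing (map_poly to_ac c)"
    using poly_rel_map_poly by auto
  then obtain p q where p: "p \<noteq> 0" "poly p a = 0" and pq: "poly_rel M p q"
    and minimal: "\<And>f. ?vanishing f \<Longrightarrow> degree p \<le> degree f"
    using ex_has_least_nat[of ?vanishing _ degree] by metis
  have "degree p > 0"
    using p by (metis degree_eq_zeroE gr0I pCons_0_0 poly_const_conv)
  then obtain b where b: "poly q b = 0"
    using alg_closed_imp_poly_has_root poly_rel_degree[OF pq] by metis
  have "poly g b = 0" if fg: "poly_rel M f g" and "poly f a = 0" for f g
  proof -
    have "poly (f mod p) a = 0"
      using that p(2) by (metis poly_mod)
    then have "f mod p = 0"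
      using minimal[of "f mod p"] poly_rel_mod[OF fg pq] degree_mod_less[OF p(1), of f]
      by fastforce
    then have "q dvd g"
      using poly_rel_eq_0_iff[OF poly_rel_mod[OF fg pq]] by (simp add: dvd_eq_mod_eq_0)
    then show ?thesis using b by (auto elim!: dvdE)
  qed
  then show thesis using adjoin that by metis
qed

lemma partial_hom_Union_chain:
  assumes "C \<noteq> {}" and chain: "subset.chain {M. partial_hom \<psi> M} C"
  shows "partial_hom \<psi> (\<Union>C)"
proof -
  have partial: "partial_hom \<psi> M" if "M \<in> C" for M
    using chain that by (auto simp: subset.chain_def)
  obtain M0 where "M0 \<in> C" using \<open>C \<noteq> {}\<close> by blast
  interpret M0: partial_hom \<psi> M0 using partial \<open>M0 \<in> C\<close> .
  have common: "\<exists>M\<in>C. z \<in> M \<and> z' \<in> M" if "z \<in> \<Union>C" "z' \<in> \<Union>C" for z z'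
    using that chain unfolding subset.chain_def by blast
  show ?thesis
  proof unfold_locales
    show "(to_ac a, \<psi> a) \<in> \<Union>C" for a using M0.extends \<open>M0 \<in> C\<close> by blast
  next
    fix x y x' y' assume "(x, y) \<in> \<Union>C" "(x', y') \<in> \<Union>C"
    then obtain M where "M \<in> C" "(x, y) \<in> M" "(x', y') \<in> M" using common by blast
    then show "(x + x', y + y') \<in> \<Union>C" "(x * x', y * y') \<in> \<Union>C"
      using partial_hom.add_mem partial_hom.mult_mem partial by blast+
  next
    fix x y y' assume "(x, y) \<in> \<Union>C" "(x, y') \<in> \<Union>C"
    then obtain M where "M \<in> C" "(x, y) \<in> M" "(x, y') \<in> M" using common by blast
    then show "y = y'" using partial_hom.single_valued partial by blast
  qed
qed

lemma partial_hom_extend_total: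
  fixes \<psi> :: "'a::field \<Rightarrow> 'b::alg_closed_field"
  assumes "partial_hom \<psi> M"
  obtains \<Phi> where "field_hom \<Phi>" "\<And>x y. (x, y) \<in> M \<Longrightarrow> \<Phi> x = y"
proof -
  define extensions where "extensions = {N. partial_hom \<psi> N \<and> M \<subseteq> N}"
  have "\<exists>N\<in>extensions. \<forall>N'\<in>extensions. N \<subseteq> N' \<longrightarrow> N' = N"
  proof (rule subset_Zorn_nonempty)
    show "extensions \<noteq> {}" using assms by (auto simp: extensions_def)
  next
    fix C assume "C \<noteq> {}" "subset.chain extensions C"
    then show "\<Union>C \<in> extensions"
      using partial_hom_Union_chain[of C \<psi>]
      unfolding extensions_def subset.chain_def by blast
  qed
  then obtain N where "N \<in> extensions"
    and maximal: "\<forall>N'\<in>extensions. N \<subseteq> N' \<longrightarrow> N' = N" ..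
  then have "partial_hom \<psi> N" "M \<subseteq> N" by (simp_all add: extensions_def)
  interpret N: partial_hom \<psi> N by fact
  have "\<exists>y. (x, y) \<in> N" for x
  proof -
    obtain y N' where "partial_hom \<psi> N'" "N \<subseteq> N'" "(x, y) \<in> N'"
      by (rule partial_hom_extend_to_element[OF \<open>partial_hom \<psi> N\<close>])
    moreover from this have "N' = N"
      using maximal \<open>M \<subseteq> N\<close> by (simp add: extensions_def)
    ultimately show ?thesis by blast
  qed
  then obtain \<Phi> where graph: "\<And>x. (x, \<Phi> x) \<in> N" by metis
  have \<Phi>_eq: "\<Phi> x = y" if "(x, y) \<in> N" for x y
    using N.single_valued graph that by blast
  have "field_hom \<Phi>"
    by unfold_locales (auto intro: \<Phi>_eq N.zero_mem N.one_mem N.add_mem N.mult_mem graph)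
  with \<Phi>_eq \<open>M \<subseteq> N\<close> that show thesis by blast
qed

lemma partial_hom_graph:
  assumes "field_hom \<psi>"
  shows "partial_hom \<psi> (range (\<lambda>a. (to_ac a, \<psi> a)))"
proof -
  interpret field_hom \<psi> by fact
  show ?thesis
    by unfold_locales (auto simp: hom_distribs simp flip: to_ac_add to_ac_mult)
qed

theorem field_hom_extend_with_root:
  fixes \<psi> :: "'a::field \<Rightarrow> 'b::alg_closed_field"
  assumes "field_hom \<psi>" "irreducible p"
    and "poly (map_poly to_ac p) x = 0" and y: "poly (map_poly \<psi> p) y = 0"
  obtains \<Phi> where "field_hom \<Phi>" "\<And>a. \<Phi> (to_ac a) = \<psi> a" "\<Phi> x = y"
proof -
  let ?M = "range (\<lambda>a. (to_ac a, \<psi> a))"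
  interpret M: partial_hom \<psi> ?M using partial_hom_graph[OF \<open>field_hom \<psi>\<close>] .
  interpret poly_hom: map_poly_comm_ring_hom \<psi> by unfold_locales
  have root: "poly g y = 0" if rel: "poly_rel ?M f g" and "poly f x = 0" for f g
  proof -
    define q where "q = map_poly of_ac f"
    have "coeff f i = to_ac (coeff q i) \<and> coeff g i = \<psi> (coeff q i)" for i
    proof -
      have "(coeff f i, coeff g i) \<in> ?M" using rel unfolding poly_rel_def by blast
      then show ?thesis by (auto simp: q_def coeff_map_poly)
    qed
    then have f: "f = map_poly to_ac q" and g: "g = map_poly \<psi> q"
      by (auto intro: poly_eqI)
    have "p dvd q"
      using irreducible_dvd_of_common_root[OF to_ac.field_hom_axioms assms(2,3)] that f by blast
    then have "map_poly \<psi> p dvd g" using g by blast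
    then show ?thesis using y by (auto elim!: dvdE)
  qed
  obtain M' where M': "partial_hom \<psi> M'" "(x, y) \<in> M'"
    by (rule M.adjoin[of x y]) (blast intro: root)+
  then obtain \<Phi> where "field_hom \<Phi>" "\<And>x y. (x, y) \<in> M' \<Longrightarrow> \<Phi> x = y"
    using partial_hom_extend_total by blast
  then show thesis
    using partial_hom.extends[OF M'(1)] M'(2) by (intro that[of \<Phi>]) auto
qed

corollary field_hom_extend_to_alg_closure:
  fixes \<psi> :: "'a::field \<Rightarrow> 'b::alg_closed_field"
  assumes "field_hom \<psi>"
  obtains \<Phi> where "field_hom \<Phi>" "\<And>a. \<Phi> (to_ac a) = \<psi> a"
  using partial_hom_extend_total[OF partial_hom_graph[OF assms]] by (metis rangeI)

lemma root_in_range_field_hom: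
  fixes \<Phi> :: "'a::alg_closed_field \<Rightarrow> 'b::field"
  assumes "field_hom \<Phi>" "p \<noteq> 0" "poly (map_poly \<Phi> p) y = 0"
  shows "y \<in> range \<Phi>"
proof -
  interpret field_hom \<Phi> by fact
  interpret poly_hom: map_poly_comm_ring_hom \<Phi> by unfold_locales
  obtain A where p: "p = smult (lead_coeff p) (\<Prod>x\<in>#A. [:- x, 1:])"
    using alg_closed_imp_factorization[OF \<open>p \<noteq> 0\<close>] by blast
  have "poly (map_poly \<Phi> (\<Prod>x\<in>#A. [:- x, 1:])) y = (\<Prod>x\<in>#A. y - \<Phi> x)"
    by (induction A) (simp_all add: hom_distribs del: mult_pCons_left poly_hom.prod_mset_image)
  then have "\<Phi> (lead_coeff p) * (\<Prod>x\<in>#A. y - \<Phi> x) = 0"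
    using assms(3) p by (metis map_poly_hom_smult poly_smult)
  then show ?thesis using \<open>p \<noteq> 0\<close> by auto
qed

lemma bij_field_hom_alg_closure:
  fixes \<Phi> :: "'a::field alg_closure \<Rightarrow> 'a alg_closure"
  assumes "field_hom \<Phi>" and base: "range to_ac \<subseteq> range \<Phi>"
  shows "bij \<Phi>"
proof -
  interpret field_hom \<Phi> by fact
  have "y \<in> range \<Phi>" for y
  proof -
    obtain p :: "'a poly" where "p \<noteq> 0" and root: "poly (map_poly to_ac p) y = 0"
      by (rule alg_closure_algebraic)
    define q where "q = map_poly (inv_into UNIV \<Phi> \<circ> to_ac) p"
    have q: "map_poly \<Phi> q = map_poly to_ac p"
    proof (rule poly_eqI)
      fix i
      have "inv_into UNIV \<Phi> 0 = 0" using inv_f_f[of 0] by simp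
      moreover have "\<Phi> (inv_into UNIV \<Phi> (to_ac (coeff p i))) = to_ac (coeff p i)"
        using base by (intro f_inv_into_f) blast
      ultimately show "coeff (map_poly \<Phi> q) i = coeff (map_poly to_ac p) i"
        by (simp add: q_def coeff_map_poly)
    qed
    then have "q \<noteq> 0" using \<open>p \<noteq> 0\<close> by auto
    then show ?thesis using root_in_range_field_hom[OF assms(1)] q root by metis
  qed
  then show ?thesis using inj_f by (auto simp: bij_def)
qed

section \<open>Automorphisms over the base field\<close>

lemma base_autos_iff: "\<sigma> \<in> base_autos \<longleftrightarrow> field_hom \<sigma> \<and> (\<forall>a. \<sigma> (to_ac a) = to_ac a)"
proof
  assume \<sigma>: "\<sigma> \<in> base_autos"
  then have "\<sigma> 0 = 0" "\<sigma> 1 = 1"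
    by (auto simp: base_autos_def) (metis to_ac_0, metis to_ac_1)
  then have "field_hom \<sigma>"
    using \<sigma> unfolding base_autos_def by unfold_locales blast+
  then show "field_hom \<sigma> \<and> (\<forall>a. \<sigma> (to_ac a) = to_ac a)"
    using \<sigma> by (simp add: base_autos_def)
next
  assume \<sigma>: "field_hom \<sigma> \<and> (\<forall>a. \<sigma> (to_ac a) = to_ac a)"
  then interpret field_hom \<sigma> by blast
  have "range to_ac \<subseteq> range \<sigma>" using \<sigma> by (metis image_subsetI rangeI)
  then have "bij \<sigma>" using \<sigma> bij_field_hom_alg_closure by blast
  then show "\<sigma> \<in> base_autos" using \<sigma> by (simp add: base_autos_def hom_distribs)
qed

lemma bij_base_auto: "\<sigma> \<in> base_autos \<Longrightarrow> bij \<sigma>"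
  by (simp add: base_autos_def)

lemma id_base_autos: "id \<in> base_autos"
  by (simp add: base_autos_def)

lemma comp_base_autos: "\<sigma> \<in> base_autos \<Longrightarrow> \<tau> \<in> base_autos \<Longrightarrow> \<sigma> \<circ> \<tau> \<in> base_autos"
  by (auto simp: base_autos_def intro: bij_comp)

lemma conjugate_base_auto:
  assumes "field_hom \<Psi>" "bij \<Psi>" "\<Psi> ` range to_ac \<subseteq> range to_ac" and \<tau>: "\<tau> \<in> base_autos"
  shows "inv_into UNIV \<Psi> \<circ> \<tau> \<circ> \<Psi> \<in> base_autos"
  unfolding base_autos_iff
proof (intro conjI allI)
  show "field_hom (inv_into UNIV \<Psi> \<circ> \<tau> \<circ> \<Psi>)"
    using assms by (intro field_hom_comp field_hom_inv_into) (auto simp: base_autos_iff)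
  show "(inv_into UNIV \<Psi> \<circ> \<tau> \<circ> \<Psi>) (to_ac a) = to_ac a" for a
  proof -
    obtain b where "\<Psi> (to_ac a) = to_ac b" using assms(3) by blast
    then show ?thesis
      using \<tau> \<open>bij \<Psi>\<close> by (simp add: base_autos_iff) (metis bij_is_inj inv_f_f)
  qed
qed

lemma inv_into_base_autos:
  assumes \<sigma>: "\<sigma> \<in> base_autos"
  shows "inv_into UNIV \<sigma> \<in> base_autos"
proof -
  have "inv_into UNIV \<sigma> (to_ac a) = to_ac a" for a
    using \<sigma> bij_base_auto[OF \<sigma>] by (simp add: base_autos_iff inv_f_eq bij_is_inj)
  then show ?thesis
    using \<sigma> bij_base_auto[OF \<sigma>] field_hom_inv_into unfolding base_autos_iff by blast
qed

theorem base_auto_between_roots: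
  assumes "irreducible p" "poly (map_poly to_ac p) x = 0" "poly (map_poly to_ac p) y = 0"
  obtains \<sigma> where "\<sigma> \<in> base_autos" "\<sigma> x = y"
  using field_hom_extend_with_root[OF to_ac.field_hom_axioms assms] base_autos_iff that by metis

section \<open>Irreducibility over fraction fields\<close>

lemma monic_add_lower_degree:
  assumes "monic p" "degree q < degree p"
  shows "monic (p + q)" "degree (p + q) = degree p"
  using assms by (simp_all add: degree_add_eq_left coeff_eq_0)

lemma primitive_if_monic:
  fixes p :: "'a::comm_ring_1 poly"
  assumes "monic p"
  shows "primitive p"
proof (rule primitiveI)
  have "p \<noteq> 0" using assms by auto
  then have "lead_coeff p \<in> set (coeffs p)" by (simp add: coeff_in_coeffs)
  then show "x dvd 1" if "\<And>y. y \<in> set (coeffs p) \<Longrightarrow> x dvd y" for x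
    using that assms by metis
qed

lemma not_dvd_coeff_mult:
  fixes g h :: "'a::idom poly"
  assumes "prime_elem c"
    and g: "\<not> c dvd coeff g i" "\<And>k. k < i \<Longrightarrow> c dvd coeff g k"
    and h: "\<not> c dvd coeff h j" "\<And>k. k < j \<Longrightarrow> c dvd coeff h k"
  shows "\<not> c dvd coeff (g * h) (i + j)"
proof -
  let ?term = "\<lambda>k. coeff g k * coeff h (i + j - k)"
  have "coeff (g * h) (i + j) = ?term i + (\<Sum>k\<in>{..i + j} - {i}. ?term k)"
    unfolding coeff_mult by (rule sum.remove) auto
  moreover have "c dvd (\<Sum>k\<in>{..i + j} - {i}. ?term k)"
  proof (rule dvd_sum)
    fix k assume "k \<in> {..i + j} - {i}"
    then show "c dvd ?term k" using g(2)[of k] h(2)[of "i + j - k"] by (cases "k < i") auto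
  qed
  moreover have "\<not> c dvd ?term i"
    using g(1) h(1) prime_elem_dvd_mult_iff[OF assms(1)] by simp
  ultimately show ?thesis by (simp add: dvd_add_left_iff)
qed

lemma eisenstein_trivial_factor:
  fixes g h :: "'a::idom poly"
  assumes c: "prime_elem c" "\<not> c dvd lead_coeff (g * h)"
    and lower: "\<And>i. i < degree (g * h) \<Longrightarrow> c dvd coeff (g * h) i"
    and "\<not> c\<^sup>2 dvd coeff (g * h) 0"
  shows "degree g = 0 \<or> degree h = 0"
proof (rule ccontr)
  assume positive: "\<not> (degree g = 0 \<or> degree h = 0)"
  then have "g \<noteq> 0" "h \<noteq> 0" by auto
  then have degree: "degree (g * h) = degree g + degree h" by (rule degree_mult_eq)
  have "\<not> c dvd coeff g (degree g)" "\<not> c dvd coeff h (degree h)"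
    using c by (auto simp: lead_coeff_mult)
  then obtain i j where g: "\<not> c dvd coeff g i" "\<And>k. k < i \<Longrightarrow> c dvd coeff g k"
    and h: "\<not> c dvd coeff h j" "\<And>k. k < j \<Longrightarrow> c dvd coeff h k"
    using exists_least_iff[of "\<lambda>i. \<not> c dvd coeff g i"]
      exists_least_iff[of "\<lambda>i. \<not> c dvd coeff h i"] by blast
  have "i \<le> degree g" "j \<le> degree h"
    using g(1) h(1) by (metis coeff_eq_0 dvd_0_right not_le)+
  moreover have "\<not> i + j < degree (g * h)"
    using not_dvd_coeff_mult[OF c(1) g h] lower by blast
  ultimately have "i = degree g" "j = degree h" using degree by linarith+
  then have "c * c dvd coeff g 0 * coeff h 0"
    using positive g(2) h(2) by (intro mult_dvd_mono) auto
  then show False using assms(4) by (simp add: coeff_mult power2_eq_square)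
qed

theorem eisenstein:
  fixes p :: "'a::idom poly"
  assumes "primitive p" "degree p > 0"
    and "prime_elem c" "\<not> c dvd lead_coeff p" "\<And>i. i < degree p \<Longrightarrow> c dvd coeff p i"
      "\<not> c\<^sup>2 dvd coeff p 0"
  shows "irreducible p"
proof (rule irreducibleI)
  show "p \<noteq> 0" "\<not> p dvd 1"
    using \<open>degree p > 0\<close> by (auto simp: poly_dvd_1)
  have unit: "f dvd 1" if "f dvd p" "degree f = 0" for f
  proof -
    obtain a where f: "f = [:a:]" using \<open>degree f = 0\<close> by (rule degree_eq_zeroE)
    with \<open>f dvd p\<close> have "a dvd y" if "y \<in> set (coeffs p)" for y
      using that by (auto simp: const_poly_dvd_iff coeffs_def split: if_splits)
    then show ?thesis using \<open>primitive p\<close> f by (auto dest: primitiveD)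
  qed
  fix g h assume p: "p = g * h"
  have "degree g = 0 \<or> degree h = 0"
    using assms(3-) unfolding p by (rule eisenstein_trivial_factor)
  then show "g dvd 1 \<or> h dvd 1" using unit p by auto
qed

lemma irreducible_map_poly_to_fract:
  fixes p :: "'a::ufd poly"
  assumes "irreducible p" "degree p > 0"
  shows "irreducible (map_poly to_fract p)"
  using irreducible_PM_M_PFM[OF assms(1)] assms(2) by simp

lemma irreducible_monic_quadratic:
  fixes a b :: "'a::idom"
  assumes no_root: "\<And>x. poly [:b, a, 1:] x \<noteq> 0"
  shows "irreducible [:b, a, 1:]"
proof (rule irreducibleI)
  show "\<not> [:b, a, 1:] dvd 1" by (simp add: poly_dvd_1)
  fix g h assume gh: "[:b, a, 1:] = g * h"
  then have "g \<noteq> 0" "h \<noteq> 0" by auto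
  then have degrees: "degree g + degree h = 2"
    using arg_cong[OF gh, of degree] by (simp add: degree_mult_eq)
  have lead: "lead_coeff g * lead_coeff h = 1"
    using arg_cong[OF gh, of lead_coeff] by (simp add: lead_coeff_mult)
  have "degree g \<noteq> 1"
  proof
    assume "degree g = 1"
    then obtain c d where g: "g = [:c, d:]" by (metis degree1_coeffs)
    with \<open>degree g = 1\<close> have "d * lead_coeff h = 1" using lead by auto
    then have "poly g (- (c * lead_coeff h)) = 0" by (simp add: g algebra_simps)
    then show False using no_root gh by (metis mult_zero_left poly_mult)
  qed
  then have "degree g = 0 \<or> degree h = 0" using degrees by linarith
  moreover have "lead_coeff g dvd 1" "lead_coeff h dvd 1"
    using lead by (metis dvd_triv_left, metis dvd_triv_right)
  ultimately show "g dvd 1 \<or> h dvd 1" by (auto simp: poly_dvd_1)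
qed simp

section \<open>Homomorphisms of fraction fields\<close>

lemma field_hom_extend_to_fract:
  fixes f :: "'a::idom \<Rightarrow> 'b::field"
  assumes "inj_comm_ring_hom f"
  obtains F where "field_hom F" "\<And>x. F (to_fract x) = f x"
proof -
  interpret inj_comm_ring_hom f by fact
  have "\<exists>a b. x = Fract a b \<and> b \<noteq> 0" for x :: "'a fract" by (cases x) auto
  then obtain num den where fract: "\<And>x :: 'a fract. x = Fract (num x) (den x)"
    and den: "\<And>x. den x \<noteq> 0"
    by metis
  define F where "F x = f (num x) / f (den x)" for x
  have F: "F (Fract a b) = f a / f b" if "b \<noteq> 0" for a b
  proof -
    let ?x = "Fract a b"
    have "a * den ?x = num ?x * b"
      using fract[of ?x] den[of ?x] \<open>b \<noteq> 0\<close> by (metis eq_fract(1))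
    then have "f a * f (den ?x) = f (num ?x) * f b" by (metis hom_mult)
    then show ?thesis using den[of ?x] \<open>b \<noteq> 0\<close> by (simp add: F_def field_simps)
  qed
  have "field_hom F"
  proof
    show "F 0 = 0" "F 1 = 1"
      using F[of 1 0] F[of 1 1] by (simp_all add: Zero_fract_def One_fract_def)
    fix x y :: "'a fract"
    obtain a b c d where x: "x = Fract a b" "b \<noteq> 0" and y: "y = Fract c d" "d \<noteq> 0"
      using fract den by metis
    then show "F (x + y) = F x + F y" "F (x * y) = F x * F y"
      by (simp_all add: F hom_distribs add_frac_eq)
  qed
  moreover have "F (to_fract x) = f x" for x by (simp add: to_fract_def F)
  ultimately show thesis by (rule that)
qed

lemma field_hom_fract_pcompose:
  fixes q :: "'a::idom poly"
  assumes "degree q > 0"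
  obtains \<psi> where "field_hom \<psi>" "\<And>p. \<psi> (to_fract p) = to_fract (p \<circ>\<^sub>p q)"
proof -
  have "inj_comm_ring_hom (\<lambda>p. to_fract (p \<circ>\<^sub>p q))"
    using assms
    by unfold_locales (auto simp: hom_distribs pcompose_mult pcompose_add pcompose_eq_0_iff)
  then show thesis using field_hom_extend_to_fract that by metis
qed

lemma poly_fract_induct [case_names const var add mult divide]:
  fixes x :: "'a::idom poly fract"
  assumes const: "\<And>c. P (to_fract [:c:])"
    and var: "P (to_fract [:0, 1:])"
    and add: "\<And>x y. P x \<Longrightarrow> P y \<Longrightarrow> P (x + y)"
    and mult: "\<And>x y. P x \<Longrightarrow> P y \<Longrightarrow> P (x * y)"
    and divide: "\<And>x y. P x \<Longrightarrow> P y \<Longrightarrow> P (x / y)"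
  shows "P x"
proof -
  have poly: "P (to_fract p)" for p
  proof (induction p)
    case 0
    then show ?case using const[of 0] by simp
  next
    case (pCons c p)
    have "pCons c p = [:c:] + [:0, 1:] * p" by simp
    then have "to_fract (pCons c p) = to_fract [:c:] + to_fract [:0, 1:] * to_fract p"
      by (simp only: to_fract_add to_fract_mult)
    then show ?case using add[OF const mult[OF var pCons.IH]] by simp
  qed
  obtain a b where "x = Fract a b" by (cases x) auto
  then show ?thesis using divide[OF poly poly] by (simp add: Fract_conv_to_fract)
qed

section \<open>The additive polynomial\<close>

definition L :: "'a::comm_ring_1 \<Rightarrow> 'a \<Rightarrow> 'a" where
  "L s x = x\<^sup>2 + s * x"

definition G :: "'a::comm_ring_1 \<Rightarrow> 'a \<Rightarrow> 'a \<Rightarrow> 'a" where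
  "G s t x = L s x + t"

primrec L_poly :: "'a::comm_ring_1 \<Rightarrow> nat \<Rightarrow> 'a poly" where
  "L_poly s 0 = [:0, 1:]"
| "L_poly s (Suc n) = (L_poly s n)\<^sup>2 + smult s (L_poly s n)"

lemma (in comm_ring_hom) hom_L: "hom (L s x) = L (hom s) (hom x)"
  by (simp add: L_def hom_distribs)

lemma (in comm_ring_hom) hom_L_funpow: "hom ((L s ^^ n) x) = (L (hom s) ^^ n) (hom x)"
  by (induction n) (simp_all add: hom_L)

lemma (in comm_ring_hom) map_poly_L_poly: "map_poly hom (L_poly s n) = L_poly (hom s) n"
proof -
  interpret poly_hom: map_poly_comm_ring_hom hom by unfold_locales
  show ?thesis by (induction n) (simp_all add: hom_distribs)
qed

lemma poly_L_poly: "poly (L_poly s n) x = (L s ^^ n) x"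
  by (induction n) (simp_all add: L_def)

lemma coeff_0_L_poly: "coeff (L_poly s n) 0 = 0"
  by (induction n) (simp_all add: power2_eq_square coeff_mult)

lemma monic_degree_L_poly:
  fixes s :: "'a::idom"
  shows "monic (L_poly s n) \<and> degree (L_poly s n) = 2 ^ n"
proof (induction n)
  case (Suc n)
  let ?p = "L_poly s n"
  have "?p \<noteq> 0" using Suc by auto
  then have degree: "degree (?p\<^sup>2) = 2 ^ Suc n"
    using Suc by (simp add: degree_power_eq)
  have "monic (?p\<^sup>2)" using Suc by (blast intro: monic_power)
  moreover have "degree (smult s ?p) < degree (?p\<^sup>2)"
    unfolding degree using Suc by (intro le_less_trans[OF degree_smult_le]) simp
  ultimately show ?case
    using monic_add_lower_degree degree by (metis L_poly.simps(2))
qed simp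

lemma dvd_L_poly_diff_monom: "[:s:] dvd L_poly s n - monom 1 (2 ^ n)"
proof (induction n)
  case (Suc n)
  let ?p = "L_poly s n" and ?m = "monom 1 (2 ^ n)"
  have "L_poly s (Suc n) - monom 1 (2 ^ Suc n) = (?p - ?m) * (?p + ?m) + [:s:] * ?p"
    by (simp add: power2_eq_square algebra_simps mult_monom mult_2)
  then show ?case using Suc by (metis dvd_add dvd_mult2 dvd_triv_left)
qed (simp add: monom_altdef)

lemma irreducible_L_poly_plus:
  fixes s :: "'a::idom"
  assumes "prime_elem s"
  shows "irreducible (L_poly s n + [:s:])"
proof -
  let ?p = "L_poly s n + [:s:]"
  have "s \<noteq> 0" "\<not> s dvd 1"
    using assms by (auto dest: prime_elem_not_zeroI prime_elem_not_unit)
  have "degree [:s:] < degree (L_poly s n)" by (simp add: monic_degree_L_poly)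
  then have monic: "monic ?p" and degree: "degree ?p = 2 ^ n"
    using monic_add_lower_degree monic_degree_L_poly by metis+
  show ?thesis
  proof (rule eisenstein[OF primitive_if_monic[OF monic] _ assms])
    show "degree ?p > 0" "\<not> s dvd lead_coeff ?p"
      using degree monic \<open>\<not> s dvd 1\<close> by simp_all
    show "\<not> s\<^sup>2 dvd coeff ?p 0"
      using \<open>s \<noteq> 0\<close> \<open>\<not> s dvd 1\<close> by (simp add: coeff_0_L_poly power2_eq_square)
    fix i assume "i < degree ?p"
    then have "coeff ?p i = coeff (L_poly s n - monom 1 (2 ^ n) + [:s:]) i"
      by (simp add: degree)
    moreover have "[:s:] dvd L_poly s n - monom 1 (2 ^ n) + [:s:]"
      using dvd_L_poly_diff_monom by (intro dvd_add) auto
    ultimately show "s dvd coeff ?p i" by (simp only: const_poly_dvd_iff)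
  qed
qed

section \<open>The kernels of the iterates\<close>

locale additive_quadratic =
  fixes s t :: "'a::alg_closed_field"
  assumes char_2: "CHAR('a) = 2" and s_nonzero: "s \<noteq> 0"
begin

lemma two_eq_0: "(2::'a) = 0"
  using of_nat_CHAR[where 'a='a] by (simp add: char_2)

lemma add_self [simp]: "x + x = (0::'a)"
  using two_eq_0 by (metis mult_2 mult_zero_left)

lemma add_self_left [simp]: "x + (x + y) = (y::'a)"
  by (simp flip: add.assoc)

lemma add_eq_0_iff_eq [simp]: "x + y = 0 \<longleftrightarrow> x = (y::'a)"
  by (metis add_self add_left_cancel)

definition L_linear :: "('a \<Rightarrow> 'a) \<Rightarrow> bool" where
  "L_linear f \<longleftrightarrow> (\<forall>x y. f (x + y) = f x + f y) \<and> (\<forall>x. f (L s x) = L s (f x))"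

lemma L_linear_add: "L_linear f \<Longrightarrow> f (x + y) = f x + f y"
  and L_linear_L: "L_linear f \<Longrightarrow> f (L s x) = L s (f x)"
  by (simp_all add: L_linear_def)

lemma L_linear_zero: "L_linear f \<Longrightarrow> f 0 = 0"
  by (metis L_linear_add add_self)

lemma L_linear_commutes_funpow: "L_linear f \<Longrightarrow> f ((L s ^^ n) x) = (L s ^^ n) (f x)"
  by (induction n) (simp_all add: L_linear_L)

lemma L_zero [simp]: "L s 0 = 0"
  by (simp add: L_def)

lemma L_add: "L s (x + y) = L s x + L s y"
  by (simp add: L_def power2_sum two_eq_0 algebra_simps)

lemma L_linear_funpow: "L_linear (L s ^^ n)"
proof -
  have "(L s ^^ n) (x + y) = (L s ^^ n) x + (L s ^^ n) y" for x y
    by (induction n) (simp_all add: L_add)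
  then show ?thesis by (simp add: L_linear_def funpow_swap1)
qed

lemmas L_funpow_add = L_linear_add[OF L_linear_funpow]
lemmas L_funpow_zero [simp] = L_linear_zero[OF L_linear_funpow]

lemma L_linear_id_plus: "L_linear f \<Longrightarrow> L_linear (\<lambda>x. x + f x)"
  by (simp add: L_linear_def L_add ac_simps)

lemma surj_L: "surj (L s)"
  unfolding surj_def
proof
  fix y
  obtain x where "poly [:y, s, 1:] x = 0"
    using alg_closed_imp_poly_has_root[of "[:y, s, 1:]"] by auto
  then have "y = L s x" by (simp add: L_def power2_eq_square algebra_simps)
  then show "\<exists>x. y = L s x" ..
qed

definition L_submodule :: "'a set \<Rightarrow> bool" where
  "L_submodule S \<longleftrightarrow> 0 \<in> S \<and> (\<forall>x\<in>S. \<forall>y\<in>S. x + y \<in> S) \<and> (\<forall>x\<in>S. L s x \<in> S)"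

lemma L_submoduleI:
  assumes "0 \<in> S" "\<And>x y. x \<in> S \<Longrightarrow> y \<in> S \<Longrightarrow> x + y \<in> S" "\<And>x. x \<in> S \<Longrightarrow> L s x \<in> S"
  shows "L_submodule S"
  using assms by (simp add: L_submodule_def)

lemma L_submodule_zero: "L_submodule S \<Longrightarrow> 0 \<in> S"
  and L_submodule_add: "L_submodule S \<Longrightarrow> x \<in> S \<Longrightarrow> y \<in> S \<Longrightarrow> x + y \<in> S"
  and L_submodule_L: "L_submodule S \<Longrightarrow> x \<in> S \<Longrightarrow> L s x \<in> S"
  by (simp_all add: L_submodule_def)

definition cyclic :: "'a \<Rightarrow> 'a set" where
  "cyclic e = L_submodule hull {e}"

lemma L_submodule_cyclic: "L_submodule (cyclic e)"
  unfolding cyclic_def by (rule hull_in) (simp add: L_submodule_def)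

lemma generator_in_cyclic: "e \<in> cyclic e"
  by (simp add: cyclic_def hull_inc)

lemma cyclic_subset: "L_submodule S \<Longrightarrow> e \<in> S \<Longrightarrow> cyclic e \<subseteq> S"
  by (simp add: cyclic_def hull_minimal)

lemma image_cyclic:
  assumes f: "L_linear f"
  shows "f ` cyclic e = cyclic (f e)"
proof
  note f_simps = L_linear_zero[OF f] L_linear_add[OF f] L_linear_L[OF f]
  have "L_submodule {x. f x \<in> cyclic (f e)}"
    by (rule L_submoduleI)
      (auto simp: f_simps intro: L_submodule_zero L_submodule_add L_submodule_L L_submodule_cyclic)
  then have "cyclic e \<subseteq> {x. f x \<in> cyclic (f e)}"
    by (intro cyclic_subset) (simp_all add: generator_in_cyclic)
  then show "f ` cyclic e \<subseteq> cyclic (f e)" by blast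
  have "L_submodule (f ` cyclic e)"
  proof (rule L_submoduleI)
    show "0 \<in> f ` cyclic e"
      using L_submodule_zero[OF L_submodule_cyclic, of e] f_simps(1) by force
    show "x + y \<in> f ` cyclic e" if "x \<in> f ` cyclic e" "y \<in> f ` cyclic e" for x y
      using that L_submodule_add[OF L_submodule_cyclic] by (auto simp flip: f_simps(2))
    show "L s x \<in> f ` cyclic e" if "x \<in> f ` cyclic e" for x
      using that L_submodule_L[OF L_submodule_cyclic] by (auto simp flip: f_simps(3))
  qed
  then show "cyclic (f e) \<subseteq> f ` cyclic e"
    using generator_in_cyclic by (intro cyclic_subset) blast+
qed

lemma L_linear_eq_on_cyclic:
  assumes f: "L_linear f" and g: "L_linear g" and "f e = g e" "x \<in> cyclic e"
  shows "f x = g x"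
proof -
  have "L_submodule {x. f x = g x}"
    using f g by (simp add: L_submodule_def L_linear_zero L_linear_add L_linear_L)
  then show ?thesis using cyclic_subset[of "{x. f x = g x}" e] assms by blast
qed

definition W :: "nat \<Rightarrow> 'a set" where
  "W n = {x. (L s ^^ n) x = 0}"

text \<open>Note the shift of the index: \<open>generators n\<close> will consist of the generators of \<open>W (Suc n)\<close>.\<close>

definition generators :: "nat \<Rightarrow> 'a set" where
  "generators n = {x. (L s ^^ n) x = s}"

lemma L_eq_0_iff: "L s x = 0 \<longleftrightarrow> x = 0 \<or> x = s"
proof -
  have "L s x = x * (x + s)" by (simp add: L_def power2_eq_square algebra_simps)
  then show ?thesis by simp
qed

lemma W_0: "W 0 = {0}"
  by (simp add: W_def)

lemma W_Suc: "W (Suc n) = W n \<union> generators n"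
  by (auto simp: W_def generators_def L_eq_0_iff)

lemma W_disjoint_generators: "W n \<inter> generators n = {}"
  using s_nonzero by (auto simp: W_def generators_def)

lemma W_subset_Suc: "W n \<subseteq> W (Suc n)"
  by (simp add: W_Suc)

lemma generators_subset_W: "generators n \<subseteq> W (Suc n)"
  by (simp add: W_Suc)

lemma L_submodule_W: "L_submodule (W n)"
  by (rule L_submoduleI) (simp_all add: W_def L_funpow_add flip: funpow_swap1)

lemma generators_nonempty: "generators n \<noteq> {}"
proof -
  obtain w where "s = (L s ^^ n) w" using surjD[OF surj_fn[OF surj_L, of n], of s] by blast
  from this[symmetric] show ?thesis by (auto simp: generators_def)
qed

lemma generators_add_in_W: "w \<in> generators n \<Longrightarrow> w' \<in> generators n \<Longrightarrow> w + w' \<in> W n"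
  by (simp add: W_def generators_def L_funpow_add)

lemma generators_eq_translate:
  assumes w: "w \<in> generators n"
  shows "generators n = (+) w ` W n"
proof (intro equalityI subsetI)
  fix x assume "x \<in> generators n"
  then show "x \<in> (+) w ` W n" using generators_add_in_W[OF w] by (metis add_self_left imageI)
qed (use w in \<open>auto simp: W_def generators_def L_funpow_add\<close>)

lemma cyclic_zero: "cyclic 0 = {0}"
  using cyclic_subset[of "{0}" 0] generator_in_cyclic[of 0] by (auto simp: L_submodule_def)

lemma cyclic_eq_W: "e \<in> generators n \<Longrightarrow> cyclic e = W (Suc n)"
proof (induction n arbitrary: e)
  case 0
  then have "e = s" by (simp add: generators_def)
  then show ?case
    using cyclic_subset[OF L_submodule_W, of s 1] L_submodule_zero[OF L_submodule_cyclic, of s]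
      generator_in_cyclic[of s]
    by (auto simp: W_def L_eq_0_iff)
next
  case (Suc n)
  have "L s e \<in> generators n" using Suc.prems by (simp add: generators_def flip: funpow_swap1)
  then have "W (Suc n) = cyclic (L s e)" by (rule Suc.IH[symmetric])
  also have "\<dots> \<subseteq> cyclic e"
    by (intro cyclic_subset L_submodule_L L_submodule_cyclic generator_in_cyclic)
  finally have "W (Suc n) \<subseteq> cyclic e" .
  moreover from this have "generators (Suc n) \<subseteq> cyclic e"
    unfolding generators_eq_translate[OF Suc.prems]
    using L_submodule_add[OF L_submodule_cyclic generator_in_cyclic] by blast
  ultimately have "W (Suc (Suc n)) \<subseteq> cyclic e"
    unfolding W_Suc[of "Suc n"] by blast
  moreover have "cyclic e \<subseteq> W (Suc (Suc n))"
    using Suc.prems generators_subset_W by (intro cyclic_subset L_submodule_W) blast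
  ultimately show ?case by blast
qed

lemma finite_W: "finite (W n)" and card_W: "card (W n) = 2 ^ n"
  and finite_generators: "finite (generators n)" and card_generators: "card (generators n) = 2 ^ n"
proof -
  have generators: "finite (generators n) \<and> card (generators n) = card (W n)"
    if "finite (W n)" for n
  proof -
    obtain w where "w \<in> generators n" using generators_nonempty by blast
    from generators_eq_translate[OF this] show ?thesis
      using that by (simp add: card_image)
  qed
  have W: "finite (W n) \<and> card (W n) = 2 ^ n" for n
  proof (induction n)
    case (Suc n)
    then show ?case
      using generators[of n] by (simp add: W_Suc card_Un_disjoint W_disjoint_generators)
  qed (simp add: W_0)
  show "finite (W n)" "card (W n) = 2 ^ n" using W by simp_all
  show "finite (generators n)" "card (generators n) = 2 ^ n" using W generators by simp_all
qed

lemma card_Sigma_cyclic: "3 * card (SIGMA e:W n. cyclic e) = 2 * 4 ^ n + 1"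
proof -
  have "3 * (\<Sum>e\<in>W n. card (cyclic e)) = 2 * 4 ^ n + 1"
  proof (induction n)
    case 0
    then show ?case by (simp add: W_0 cyclic_zero)
  next
    case (Suc n)
    have "(\<Sum>e\<in>W (Suc n). card (cyclic e)) =
        (\<Sum>e\<in>W n. card (cyclic e)) + (\<Sum>e\<in>generators n. card (cyclic e))"
      unfolding W_Suc
      by (intro sum.union_disjoint finite_W finite_generators W_disjoint_generators)
    also have "(\<Sum>e\<in>generators n. card (cyclic e)) = (\<Sum>e\<in>generators n. 2 ^ Suc n)"
      by (intro sum.cong) (simp_all add: cyclic_eq_W card_W)
    also have "\<dots> = 2 * 4 ^ n"
      by (simp add: card_generators flip: power_mult_distrib)
    finally show ?case using Suc.IH by simp
  qed
  moreover have "finite (cyclic e)" if "e \<in> W n" for e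
    using that cyclic_subset[OF L_submodule_W] finite_W by (metis finite_subset)
  ultimately show ?thesis by (simp add: card_SigmaI finite_W)
qed

definition roots :: "nat \<Rightarrow> 'a set" where
  "roots n = {x. (G s t ^^ n) x = 0}"

lemma G_funpow_add: "(G s t ^^ n) (x + y) = (G s t ^^ n) x + (L s ^^ n) y"
  by (induction n) (simp_all add: G_def L_add ac_simps)

lemma add_in_roots_iff: "r \<in> roots n \<Longrightarrow> r + x \<in> roots n \<longleftrightarrow> x \<in> W n"
  by (simp add: roots_def W_def G_funpow_add)

lemma roots_add_in_W: "r \<in> roots n \<Longrightarrow> r' \<in> roots n \<Longrightarrow> r + r' \<in> W n"
  by (simp flip: add_in_roots_iff)

lemma roots_eq_translate:
  assumes r: "r \<in> roots n"
  shows "roots n = (+) r ` W n"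
proof (intro equalityI subsetI)
  fix x assume "x \<in> roots n"
  then show "x \<in> (+) r ` W n" using roots_add_in_W[OF r] by (metis add_self_left imageI)
qed (use r in \<open>auto simp: add_in_roots_iff\<close>)

lemma roots_nonempty: "roots n \<noteq> {}"
proof -
  have "surj (G s t)"
    unfolding surj_def
  proof
    fix y
    obtain x where "y + t = L s x" using surjD[OF surj_L] by blast
    then have "y = G s t x" by (metis G_def add.assoc add_self add_0_right)
    then show "\<exists>x. y = G s t x" ..
  qed
  then obtain r where "0 = (G s t ^^ n) r" using surjD[OF surj_fn, of "G s t" 0 n] by blast
  from this[symmetric] show ?thesis by (auto simp: roots_def)
qed

end

lemma card_image_cong_kernel:
  assumes "\<And>x y. x \<in> A \<Longrightarrow> y \<in> A \<Longrightarrow> f x = f y \<longleftrightarrow> g x = g y"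
  shows "card (f ` A) = card (g ` A)"
proof -
  define h where "h z = g (inv_into A f z)" for z
  have h: "h (f x) = g x" if "x \<in> A" for x
    using assms[of "inv_into A f (f x)" x] that by (simp add: h_def inv_into_into f_inv_into_f)
  have "inj_on h (f ` A)" using assms by (auto intro!: inj_onI simp: h)
  then have "card (h ` f ` A) = card (f ` A)" by (rule card_image)
  moreover have "h ` f ` A = g ` A" using h by (force simp: image_image)
  ultimately show ?thesis by simp
qed

section \<open>Groups acting on the roots\<close>

locale quadratic_galois = additive_quadratic +
  fixes \<Gamma> :: "('a \<Rightarrow> 'a) set"
  assumes id_mem: "id \<in> \<Gamma>"
    and comp_mem: "\<sigma> \<in> \<Gamma> \<Longrightarrow> \<tau> \<in> \<Gamma> \<Longrightarrow> \<sigma> \<circ> \<tau> \<in> \<Gamma>"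
    and bij_mem: "\<sigma> \<in> \<Gamma> \<Longrightarrow> bij \<sigma>"
    and inv_mem: "\<sigma> \<in> \<Gamma> \<Longrightarrow> inv_into UNIV \<sigma> \<in> \<Gamma>"
    and linear: "\<sigma> \<in> \<Gamma> \<Longrightarrow> L_linear \<sigma>"
    and fixes_s: "\<sigma> \<in> \<Gamma> \<Longrightarrow> \<sigma> s = s"
    and fixes_t: "\<sigma> \<in> \<Gamma> \<Longrightarrow> \<sigma> t = t"
    and moves_root: "v \<in> roots 1 \<Longrightarrow> \<exists>\<sigma>\<in>\<Gamma>. \<sigma> v \<noteq> v"
    and root_stabilizer_transitive:
      "v \<in> roots 1 \<Longrightarrow> w \<in> generators n \<Longrightarrow> w' \<in> generators n \<Longrightarrow> \<exists>\<sigma>\<in>\<Gamma>. \<sigma> v = v \<and> \<sigma> w = w'"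
begin

lemma apply_inv: "\<sigma> \<in> \<Gamma> \<Longrightarrow> \<sigma> (inv_into UNIV \<sigma> x) = x"
  and inv_apply: "\<sigma> \<in> \<Gamma> \<Longrightarrow> inv_into UNIV \<sigma> (\<sigma> x) = x"
  using bij_mem by (simp_all add: bij_is_surj surj_f_inv_f bij_is_inj)

lemma map_add: "\<sigma> \<in> \<Gamma> \<Longrightarrow> \<sigma> (x + y) = \<sigma> x + \<sigma> y"
  by (rule L_linear_add[OF linear])

lemma map_zero: "\<sigma> \<in> \<Gamma> \<Longrightarrow> \<sigma> 0 = 0"
  by (rule L_linear_zero[OF linear])

lemma map_G_funpow: "\<sigma> \<in> \<Gamma> \<Longrightarrow> \<sigma> ((G s t ^^ n) x) = (G s t ^^ n) (\<sigma> x)"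
  by (induction n) (simp_all add: G_def map_add L_linear_L[OF linear] fixes_t)

lemma map_W: "\<sigma> \<in> \<Gamma> \<Longrightarrow> x \<in> W n \<Longrightarrow> \<sigma> x \<in> W n"
  by (simp add: W_def map_zero flip: L_linear_commutes_funpow[OF linear])

lemma map_generators: "\<sigma> \<in> \<Gamma> \<Longrightarrow> w \<in> generators n \<Longrightarrow> \<sigma> w \<in> generators n"
  by (simp add: generators_def fixes_s flip: L_linear_commutes_funpow[OF linear])

lemma map_roots: "\<sigma> \<in> \<Gamma> \<Longrightarrow> r \<in> roots n \<Longrightarrow> \<sigma> r \<in> roots n"
  by (simp add: roots_def map_zero flip: map_G_funpow)

lemma eq_on_W:
  assumes "\<sigma> \<in> \<Gamma>" "\<tau> \<in> \<Gamma>" "w \<in> generators n" "\<sigma> w = \<tau> w" "x \<in> W (Suc n)"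
  shows "\<sigma> x = \<tau> x"
  using assms L_linear_eq_on_cyclic[OF linear linear] cyclic_eq_W by metis

definition translation_vectors :: "nat \<Rightarrow> 'a set" where
  "translation_vectors n = {b. \<exists>\<sigma>\<in>\<Gamma>. (\<forall>x\<in>W n. \<sigma> x = x) \<and> (\<forall>r\<in>roots n. \<sigma> r = r + b)}"

lemma translation_vectorsI:
  assumes \<sigma>: "\<sigma> \<in> \<Gamma>" "\<And>x. x \<in> W n \<Longrightarrow> \<sigma> x = x" and r: "r \<in> roots n" "\<sigma> r = r + b"
  shows "b \<in> translation_vectors n"
proof -
  have "\<sigma> r' = r' + b" if "r' \<in> roots n" for r'
  proof -
    have "\<sigma> (r + r') = r + r'" using \<sigma>(2) roots_add_in_W[OF r(1) that] .
    then have "r + (b + \<sigma> r') = r + r'" by (simp add: map_add[OF \<sigma>(1)] r(2) add.assoc)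
    then have "b + \<sigma> r' = r'" by simp
    then show ?thesis by (metis add.commute add_self_left)
  qed
  then show ?thesis using \<sigma> by (auto simp: translation_vectors_def)
qed

lemma translation_vectors_subset_W: "translation_vectors n \<subseteq> W n"
proof
  fix b assume "b \<in> translation_vectors n"
  then obtain \<sigma> where \<sigma>: "\<sigma> \<in> \<Gamma>" "\<And>r. r \<in> roots n \<Longrightarrow> \<sigma> r = r + b"
    by (auto simp: translation_vectors_def)
  obtain r where "r \<in> roots n" using roots_nonempty by blast
  then show "b \<in> W n"
    using add_in_roots_iff map_roots[OF \<sigma>(1)] \<sigma>(2) by metis
qed

lemma map_translation_vectors:
  assumes "\<tau> \<in> \<Gamma>" "b \<in> translation_vectors n"
  shows "\<tau> b \<in> translation_vectors n"
proof -
  let ?\<tau>' = "inv_into UNIV \<tau>"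
  have \<tau>': "?\<tau>' \<in> \<Gamma>" using inv_mem[OF assms(1)] .
  obtain \<sigma> where \<sigma>: "\<sigma> \<in> \<Gamma>" "\<And>x. x \<in> W n \<Longrightarrow> \<sigma> x = x" "\<And>r. r \<in> roots n \<Longrightarrow> \<sigma> r = r + b"
    using assms(2) by (auto simp: translation_vectors_def)
  obtain r where r: "r \<in> roots n" using roots_nonempty by blast
  show ?thesis
  proof (rule translation_vectorsI[OF _ _ r])
    show "\<tau> \<circ> \<sigma> \<circ> ?\<tau>' \<in> \<Gamma>" using assms(1) \<sigma>(1) \<tau>' by (intro comp_mem)
    show "(\<tau> \<circ> \<sigma> \<circ> ?\<tau>') x = x" if "x \<in> W n" for x
      using \<sigma>(2) map_W[OF \<tau>' that] apply_inv[OF assms(1)] by simp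
    show "(\<tau> \<circ> \<sigma> \<circ> ?\<tau>') r = r + \<tau> b"
      using \<sigma>(3) map_roots[OF \<tau>' r] apply_inv[OF assms(1)] by (simp add: map_add[OF assms(1)])
  qed
qed

lemma generators_transitive:
  assumes "w \<in> generators n" "w' \<in> generators n"
  obtains \<sigma> where "\<sigma> \<in> \<Gamma>" "\<sigma> w = w'"
  using root_stabilizer_transitive[OF _ assms] roots_nonempty[of 1] by blast

lemma one_plus_L_mem:
  obtains \<tau> where "\<tau> \<in> \<Gamma>" "\<And>x. x \<in> W (Suc n) \<Longrightarrow> \<tau> x = x + L s x"
proof -
  obtain w where w: "w \<in> generators n" using generators_nonempty by blast
  then have "w + L s w \<in> generators n"
    by (simp add: generators_def L_funpow_add L_eq_0_iff flip: funpow_swap1)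
  then obtain \<tau> where \<tau>: "\<tau> \<in> \<Gamma>" "\<tau> w = w + L s w"
    using generators_transitive[OF w] by blast
  have "L_linear (\<lambda>x. x + L s x)"
    using L_linear_id_plus[OF L_linear_funpow[of 1]] by simp
  then have "\<tau> x = x + L s x" if "x \<in> W (Suc n)" for x
    using L_linear_eq_on_cyclic[OF linear[OF \<tau>(1)], of "\<lambda>x. x + L s x" w x] \<tau>(2) that
    by (simp add: cyclic_eq_W[OF w])
  with \<tau>(1) that show thesis by blast
qed

text \<open>Conjugating the translation by \<open>b\<close> with an element acting as \<open>1 + L\<close> gives the translation by
  \<open>b + L b\<close>.\<close>

lemma L_submodule_translation_vectors: "L_submodule (translation_vectors (Suc n))"
proof (rule L_submoduleI)
  obtain r where r: "r \<in> roots (Suc n)" using roots_nonempty by blast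
  show "0 \<in> translation_vectors (Suc n)" using translation_vectorsI[OF id_mem _ r] by simp
  show add: "b + c \<in> translation_vectors (Suc n)"
    if "b \<in> translation_vectors (Suc n)" "c \<in> translation_vectors (Suc n)" for b c
  proof -
    obtain \<sigma> where \<sigma>: "\<sigma> \<in> \<Gamma>" "\<And>x. x \<in> W (Suc n) \<Longrightarrow> \<sigma> x = x" "\<sigma> r = r + b"
      using \<open>b \<in> _\<close> r by (auto simp: translation_vectors_def)
    obtain \<tau> where \<tau>: "\<tau> \<in> \<Gamma>" "\<And>x. x \<in> W (Suc n) \<Longrightarrow> \<tau> x = x" "\<tau> r = r + c"
      using \<open>c \<in> _\<close> r by (auto simp: translation_vectors_def)
    have "c \<in> W (Suc n)" using \<open>c \<in> _\<close> translation_vectors_subset_W by blast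
    then show ?thesis
      using \<sigma> \<tau> by (intro translation_vectorsI[OF comp_mem[OF \<sigma>(1) \<tau>(1)] _ r])
        (simp_all add: map_add[OF \<sigma>(1)] ac_simps)
  qed
  show "L s b \<in> translation_vectors (Suc n)" if b: "b \<in> translation_vectors (Suc n)" for b
  proof -
    obtain \<tau> where \<tau>: "\<tau> \<in> \<Gamma>" "\<And>x. x \<in> W (Suc n) \<Longrightarrow> \<tau> x = x + L s x"
      using one_plus_L_mem[of n] by blast
    have "b + L s b \<in> translation_vectors (Suc n)"
      using map_translation_vectors[OF \<tau>(1) b] \<tau>(2) b translation_vectors_subset_W
      by (metis subsetD)
    then show ?thesis using add[OF b] by fastforce
  qed
qed

lemma generator_in_translation_vectors:
  obtains e where "e \<in> generators n" "e \<in> translation_vectors (Suc n)"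
proof -
  obtain r where r: "r \<in> roots (Suc n)" using roots_nonempty by blast
  obtain w where w: "w \<in> generators n" using generators_nonempty by blast
  define v where "v = (G s t ^^ n) r"
  have v: "v \<in> roots 1" using r by (simp add: v_def roots_def)
  obtain \<tau> where \<tau>: "\<tau> \<in> \<Gamma>" "\<tau> v \<noteq> v" using moves_root[OF v] by blast
  obtain \<sigma> where \<sigma>: "\<sigma> \<in> \<Gamma>" "\<sigma> v = v" "\<sigma> w = \<tau> w"
    using root_stabilizer_transitive[OF v w map_generators[OF \<tau>(1) w]] by blast
  define \<rho> where "\<rho> = inv_into UNIV \<sigma> \<circ> \<tau>"
  have \<rho>: "\<rho> \<in> \<Gamma>" using \<sigma>(1) \<tau>(1) by (simp add: \<rho>_def comp_mem inv_mem)
  have "\<rho> w = w" using inv_apply[OF \<sigma>(1), of w] \<sigma>(3) by (simp add: \<rho>_def)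
  then have "\<rho> x = x" if "x \<in> W (Suc n)" for x
    using eq_on_W[OF \<rho> id_mem w] that by simp
  then have "r + \<rho> r \<in> translation_vectors (Suc n)"
    by (intro translation_vectorsI[OF \<rho> _ r]) simp_all
  moreover have "r + \<rho> r \<in> generators n"
  proof -
    have "\<rho> v \<noteq> v"
      using \<tau>(2) apply_inv[OF \<sigma>(1), of "\<tau> v"] \<sigma>(2) by (auto simp: \<rho>_def)
    moreover have "v + \<rho> v = 0 \<or> v + \<rho> v = s"
      using roots_add_in_W[OF v map_roots[OF \<rho> v]]
      by (simp add: W_def L_eq_0_iff del: add_eq_0_iff_eq)
    ultimately have "v + \<rho> v = s" by auto
    moreover have "\<rho> v = v + (L s ^^ n) (r + \<rho> r)"
      using map_G_funpow[OF \<rho>, of n r] G_funpow_add[of n r "r + \<rho> r"] by (simp add: v_def)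
    ultimately show ?thesis by (simp add: generators_def)
  qed
  ultimately show thesis using that by blast
qed

lemma translation_vectors_eq_W: "translation_vectors (Suc n) = W (Suc n)"
proof
  obtain e where "e \<in> generators n" "e \<in> translation_vectors (Suc n)"
    by (rule generator_in_translation_vectors)
  then show "W (Suc n) \<subseteq> translation_vectors (Suc n)"
    using cyclic_eq_W cyclic_subset[OF L_submodule_translation_vectors] by blast
qed (rule translation_vectors_subset_W)

lemma generator_root_transitive:
  assumes "w \<in> generators n" "w' \<in> generators n" "r \<in> roots (Suc n)" "r' \<in> roots (Suc n)"
  obtains \<sigma> where "\<sigma> \<in> \<Gamma>" "\<sigma> w = w'" "\<sigma> r = r'"
proof -
  obtain \<sigma> where \<sigma>: "\<sigma> \<in> \<Gamma>" "\<sigma> w = w'" using generators_transitive[OF assms(1,2)] .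
  have root: "\<sigma> r \<in> roots (Suc n)" using map_roots[OF \<sigma>(1) assms(3)] .
  then have "\<sigma> r + r' \<in> translation_vectors (Suc n)"
    unfolding translation_vectors_eq_W using assms(4) by (rule roots_add_in_W)
  then obtain \<rho> where \<rho>: "\<rho> \<in> \<Gamma>" "\<And>x. x \<in> W (Suc n) \<Longrightarrow> \<rho> x = x" "\<rho> (\<sigma> r) = \<sigma> r + (\<sigma> r + r')"
    using root by (auto simp: translation_vectors_def)
  show thesis
  proof
    show "\<rho> \<circ> \<sigma> \<in> \<Gamma>" by (rule comp_mem[OF \<rho>(1) \<sigma>(1)])
    show "(\<rho> \<circ> \<sigma>) w = w'"
      using \<rho>(2) \<sigma>(2) assms(2) generators_subset_W by auto
    show "(\<rho> \<circ> \<sigma>) r = r'" using \<rho>(3) by simp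
  qed
qed

definition displacement :: "'a \<Rightarrow> 'a \<Rightarrow> ('a \<Rightarrow> 'a) \<Rightarrow> 'a \<times> 'a" where
  "displacement w r \<sigma> = (w + \<sigma> w, r + \<sigma> r)"

context
  fixes n w r
  assumes w: "w \<in> generators n" and r: "r \<in> roots (Suc n)"
begin

lemma restrict_eq_iff_displacement_eq:
  assumes \<sigma>: "\<sigma> \<in> \<Gamma>" and \<tau>: "\<tau> \<in> \<Gamma>"
  shows "restrict \<sigma> (roots (Suc n)) = restrict \<tau> (roots (Suc n)) \<longleftrightarrow>
    displacement w r \<sigma> = displacement w r \<tau>"
proof
  assume "restrict \<sigma> (roots (Suc n)) = restrict \<tau> (roots (Suc n))"
  then have "\<sigma> x = \<tau> x" if "x \<in> roots (Suc n)" for x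
    using that by (metis restrict_apply')
  moreover have "r + w \<in> roots (Suc n)"
    using r w generators_subset_W by (auto simp: add_in_roots_iff)
  ultimately have "\<sigma> r = \<tau> r" "\<sigma> (r + w) = \<tau> (r + w)" using r by blast+
  then show "displacement w r \<sigma> = displacement w r \<tau>"
    by (simp add: displacement_def map_add \<sigma> \<tau>)
next
  assume "displacement w r \<sigma> = displacement w r \<tau>"
  then have "\<sigma> w = \<tau> w" "\<sigma> r = \<tau> r" by (simp_all add: displacement_def)
  have "\<sigma> x = \<tau> x" if "x \<in> roots (Suc n)" for x
  proof -
    have "\<sigma> (r + x) = \<tau> (r + x)"
      using eq_on_W[OF \<sigma> \<tau> w \<open>\<sigma> w = \<tau> w\<close>] roots_add_in_W[OF r that] .
    then show ?thesis using \<open>\<sigma> r = \<tau> r\<close> by (simp add: map_add \<sigma> \<tau>)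
  qed
  then show "restrict \<sigma> (roots (Suc n)) = restrict \<tau> (roots (Suc n))"
    by (rule restrict_ext)
qed

lemma displacement_image: "displacement w r ` \<Gamma> = W n \<times> W (Suc n)"
proof
  show "displacement w r ` \<Gamma> \<subseteq> W n \<times> W (Suc n)"
    using w r map_generators map_roots
    by (auto simp: displacement_def roots_add_in_W generators_add_in_W)
  show "W n \<times> W (Suc n) \<subseteq> displacement w r ` \<Gamma>"
  proof clarify
    fix e b assume "e \<in> W n" "b \<in> W (Suc n)"
    then have "w + e \<in> generators n" "r + b \<in> roots (Suc n)"
      using w r by (auto simp: generators_eq_translate[OF w] add_in_roots_iff)
    then obtain \<sigma> where "\<sigma> \<in> \<Gamma>" "\<sigma> w = w + e" "\<sigma> r = r + b"
      using generator_root_transitive[OF w _ r] by metis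
    then show "(e, b) \<in> displacement w r ` \<Gamma>"
      by (intro image_eqI[of _ _ \<sigma>]) (simp_all add: displacement_def)
  qed
qed

lemma fixes_root_iff:
  assumes \<sigma>: "\<sigma> \<in> \<Gamma>"
  shows "(\<exists>x\<in>roots (Suc n). \<sigma> x = x) \<longleftrightarrow> r + \<sigma> r \<in> cyclic (w + \<sigma> w)"
proof -
  have fixed_iff: "\<sigma> (r + y) = r + y \<longleftrightarrow> r + \<sigma> r = y + \<sigma> y" for y
  proof -
    have "\<sigma> (r + y) = r + y \<longleftrightarrow> (\<sigma> r + \<sigma> y) + (r + y) = 0"
      by (simp only: map_add[OF \<sigma>] add_eq_0_iff_eq)
    also have "(\<sigma> r + \<sigma> y) + (r + y) = (r + \<sigma> r) + (y + \<sigma> y)" by (simp only: ac_simps)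
    finally show ?thesis by (simp only: add_eq_0_iff_eq)
  qed
  have "(\<exists>x\<in>roots (Suc n). \<sigma> x = x) \<longleftrightarrow> (\<exists>y\<in>W (Suc n). r + \<sigma> r = y + \<sigma> y)"
    by (simp add: roots_eq_translate[OF r] fixed_iff)
  also have "\<dots> \<longleftrightarrow> r + \<sigma> r \<in> (\<lambda>y. y + \<sigma> y) ` cyclic w"
    by (auto simp: cyclic_eq_W[OF w])
  also have "(\<lambda>y. y + \<sigma> y) ` cyclic w = cyclic (w + \<sigma> w)"
    by (intro image_cyclic L_linear_id_plus linear \<sigma>)
  finally show ?thesis .
qed

lemma displacement_image_fixing_root:
  "displacement w r ` {\<sigma>\<in>\<Gamma>. \<exists>x\<in>roots (Suc n). \<sigma> x = x} = (SIGMA e:W n. cyclic e)"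
  (is "_ = ?S")
proof -
  have "displacement w r \<sigma> \<in> W n \<times> W (Suc n)" if "\<sigma> \<in> \<Gamma>" for \<sigma>
    using displacement_image that by blast
  then have "{\<sigma>\<in>\<Gamma>. \<exists>x\<in>roots (Suc n). \<sigma> x = x} = {\<sigma>\<in>\<Gamma>. displacement w r \<sigma> \<in> ?S}"
    by (intro Collect_cong conj_cong refl) (simp add: fixes_root_iff displacement_def)
  moreover have "f ` {x\<in>A. f x \<in> S} = f ` A \<inter> S" for f :: "('a \<Rightarrow> 'a) \<Rightarrow> 'a \<times> 'a" and A S
    by auto
  moreover have "?S \<subseteq> W n \<times> W (Suc n)"
    using cyclic_subset[OF L_submodule_W] W_subset_Suc by blast
  ultimately show ?thesis by (simp only: displacement_image Int_absorb1)
qed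

lemma card_restrict_image:
  assumes "A \<subseteq> \<Gamma>"
  shows "card ((\<lambda>\<sigma>. restrict \<sigma> (roots (Suc n))) ` A) = card (displacement w r ` A)"
  using assms by (intro card_image_cong_kernel restrict_eq_iff_displacement_eq) blast+

end

theorem FPP_restrict:
  "FPP ((\<lambda>\<sigma>. restrict \<sigma> (roots (Suc n))) ` \<Gamma>) (roots (Suc n)) = 1 / 3 + (1 / 4) ^ n / 6"
proof -
  let ?res = "\<lambda>\<sigma>. restrict \<sigma> (roots (Suc n))"
  obtain w where w: "w \<in> generators n" using generators_nonempty by blast
  obtain r where r: "r \<in> roots (Suc n)" using roots_nonempty by blast
  have "card (?res ` \<Gamma>) = card (W n \<times> W (Suc n))"
    by (simp add: card_restrict_image[OF w r] displacement_image[OF w r])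
  also have "\<dots> = 2 * 4 ^ n"
    by (simp add: card_cartesian_product card_W flip: power_mult_distrib)
  finally have all: "card (?res ` \<Gamma>) = 2 * 4 ^ n" .
  let ?fixing = "{g \<in> ?res ` \<Gamma>. \<exists>x\<in>roots (Suc n). g x = x}"
  have "?fixing = ?res ` {\<sigma>\<in>\<Gamma>. \<exists>x\<in>roots (Suc n). \<sigma> x = x}"
    by (auto intro!: imageI)
  then have "card ?fixing = card (SIGMA e:W n. cyclic e)"
    by (simp add: card_restrict_image[OF w r] displacement_image_fixing_root[OF w r])
  then have "real (3 * card ?fixing) = real (2 * 4 ^ n + 1)"
    by (simp only: card_Sigma_cyclic)
  then have "3 * real (card ?fixing) = 2 * 4 ^ n + 1" by simp
  then show ?thesis
    by (simp add: FPP_def all field_simps)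
qed

end

section \<open>The Galois group\<close>

lemma CHAR_fract [simp]: "CHAR('a::idom fract) = CHAR('a)"
proof (rule CHAR_eqI)
  show "of_nat CHAR('a) = (0 :: 'a fract)"
    by (simp flip: to_fract_hom.hom_of_nat)
  show "CHAR('a) dvd n" if "of_nat n = (0 :: 'a fract)" for n
    using that by (simp add: of_nat_eq_0_iff_char_dvd flip: to_fract_hom.hom_of_nat)
qed

lemma to_fract_eq_var_s: "to_fract [:[:0, 1:]:] = var_s"
  and to_fract_eq_var_t: "to_fract [:0, 1:] = var_t"
  by (simp_all add: to_fract_def var_s_def var_t_def)

lemma irreducible_L_poly_plus_var_s:
  "irreducible (L_poly var_s n + [:var_s:] :: 'k::field rfun2 poly)"
proof -
  let ?s = "[:[:0, 1:]:] :: 'k poly poly"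
  have "prime_elem ?s"
    by (intro lift_prime_elem_poly prime_elem_linear_field_poly) simp
  then have "irreducible (L_poly ?s n + [:?s:])" by (rule irreducible_L_poly_plus)
  moreover have "degree (L_poly ?s n + [:?s:]) > 0"
    by (simp add: degree_add_eq_left monic_degree_L_poly)
  ultimately have "irreducible (map_poly to_fract (L_poly ?s n + [:?s:]))"
    by (rule irreducible_map_poly_to_fract)
  moreover have "map_poly to_fract (L_poly ?s n + [:?s:]) = L_poly var_s n + [:var_s:]"
    unfolding to_fract_eq_var_s[symmetric]
    by (simp add: hom_distribs to_fract_hom.map_poly_L_poly)
  ultimately show ?thesis by simp
qed

lemma quadratic_with_variable_no_root:
  fixes a :: "'a::idom"
  shows "poly [:[:0, 1:], [:a:], 1:] p \<noteq> 0"
proof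
  assume "poly [:[:0, 1:], [:a:], 1:] p = 0"
  then have "[:0, 1:] + p * ([:a:] + p) = 0" by simp
  then have p: "p * ([:a:] + p) = - [:0, 1:]" by (simp only: add_eq_0_iff)
  then have "p \<noteq> 0" "[:a:] + p \<noteq> 0" by auto
  then have "degree p + degree ([:a:] + p) = 1"
    using arg_cong[OF p, of degree] by (simp add: degree_mult_eq)
  moreover have "degree ([:a:] + p) = degree p" if "degree p > 0"
    using that by (intro degree_add_eq_right) simp
  moreover have "degree ([:a:] + p) = 0" if "degree p = 0"
    using that degree_add_le[of "[:a:]" 0 p] by simp
  ultimately show False by (cases "degree p = 0") auto
qed

lemma irreducible_frakG: "irreducible (frakG :: 'k::field rfun2 poly)"
proof -
  let ?G = "[:[:0, 1:], [:[:0, 1:]:], 1:] :: 'k poly poly poly"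
  have "irreducible ?G"
    using quadratic_with_variable_no_root by (rule irreducible_monic_quadratic)
  then have "irreducible (map_poly to_fract ?G)"
    by (rule irreducible_map_poly_to_fract) simp
  moreover have "map_poly to_fract ?G = frakG"
    unfolding frakG_def to_fract_eq_var_s[symmetric] to_fract_eq_var_t[symmetric]
    by (simp add: map_poly_pCons)
  ultimately show ?thesis by simp
qed

lemma poly_frakG: "poly (map_poly to_ac frakG) x = G (to_ac var_s) (to_ac var_t) x"
  by (simp add: frakG_def map_poly_pCons G_def L_def power2_eq_square algebra_simps)

lemma poly_frakG_iter:
  "poly (map_poly to_ac (frakG_iter n)) x = (G (to_ac var_s) (to_ac var_t) ^^ n) x"
proof (induction n)
  case 0
  then show ?case by (simp add: frakG_iter_def map_poly_pCons)
next
  case (Suc n)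
  have "frakG_iter (Suc n) = frakG \<circ>\<^sub>p (frakG_iter n :: 'a rfun2 poly)"
    by (simp add: frakG_iter_def)
  then show ?case
    by (simp add: to_ac.map_poly_pcompose poly_pcompose poly_frakG Suc)
qed

lemma bij_field_hom_rational_function_closure:
  fixes \<Psi> :: "'a::idom poly fract alg_closure \<Rightarrow> 'a poly fract alg_closure"
  assumes "field_hom \<Psi>"
    and fixes_constants: "\<And>c. \<Psi> (to_ac (to_fract [:c:])) = to_ac (to_fract [:c:])"
    and var_in_range: "to_ac (to_fract [:0, 1:]) \<in> range \<Psi>"
  shows "bij \<Psi>"
proof -
  interpret field_hom \<Psi> by fact
  have "to_ac a \<in> range \<Psi>" for a
  proof (induction a rule: poly_fract_induct)
    case (const c)
    then show ?case using fixes_constants by (metis rangeI)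
  next
    case var
    then show ?case by (rule var_in_range)
  next
    case (add x y)
    then show ?case by (auto simp flip: hom_add)
  next
    case (mult x y)
    then show ?case by (auto simp flip: hom_mult)
  next
    case (divide x y)
    then show ?case by (auto simp flip: hom_div)
  qed
  then show ?thesis by (intro bij_field_hom_alg_closure[OF assms(1)]) auto
qed

text \<open>The substitution of \<open>L t\<close> for \<open>t\<close> identifies \<open>k(s, v)\<close>, for a root \<open>v\<close> of \<open>G\<close>, with \<open>k(s, t)\<close>;
  conjugation by its extension to the closure transfers transitivity over \<open>k(s, t)\<close> to transitivity
  over \<open>k(s, v)\<close>.\<close>

lemma isogeny_automorphism:
  obtains \<Psi> :: "'k::field rfun2 alg_closure \<Rightarrow> 'k rfun2 alg_closure"
  where "field_hom \<Psi>" "bij \<Psi>" "\<Psi> ` range to_ac \<subseteq> range to_ac"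
    "\<Psi> (to_ac var_s) = to_ac var_s" "\<Psi> (to_ac var_t) = L (to_ac var_s) (to_ac var_t)"
proof -
  let ?s = "to_ac var_s :: 'k rfun2 alg_closure" and ?t = "to_ac var_t :: 'k rfun2 alg_closure"
  let ?q = "[:0, [:0, 1:], 1:] :: 'k poly poly"
  obtain \<psi> :: "'k rfun2 \<Rightarrow> 'k rfun2"
    where \<psi>: "field_hom \<psi>" "\<And>p. \<psi> (to_fract p) = to_fract (p \<circ>\<^sub>p ?q)"
    using field_hom_fract_pcompose[of ?q] by auto
  obtain \<Psi> where \<Psi>: "field_hom \<Psi>" "\<And>a. \<Psi> (to_ac a) = to_ac (\<psi> a)"
    using field_hom_extend_to_alg_closure[OF field_hom_comp[OF to_ac.field_hom_axioms \<psi>(1)]] by auto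
  interpret field_hom \<Psi> by fact
  have fixes_constants: "\<Psi> (to_ac (to_fract [:c:])) = to_ac (to_fract [:c:])" for c
    by (simp add: \<Psi>(2) \<psi>(2))
  then have s: "\<Psi> ?s = ?s" by (simp only: flip: to_fract_eq_var_s)
  have "[:0, 1:] \<circ>\<^sub>p ?q = [:0, 1:] * [:0, 1:] + [:[:0, 1:]:] * [:0, 1:]"
    by (simp add: pcompose_pCons)
  then have "\<psi> var_t = var_t * var_t + var_s * var_t"
    using \<psi>(2)[of "[:0, 1:]"]
    by (simp only: to_fract_eq_var_s to_fract_eq_var_t to_fract_add to_fract_mult)
  then have t: "\<Psi> ?t = L ?s ?t" by (simp add: \<Psi>(2) L_def power2_eq_square)
  have "?t \<in> range \<Psi>"
  proof (rule root_in_range_field_hom[OF \<Psi>(1)])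
    show "poly (map_poly \<Psi> [:- ?t, ?s, 1:]) ?t = 0"
      by (simp add: hom_distribs s t L_def power2_eq_square algebra_simps)
  qed simp
  then have "bij \<Psi>"
    using bij_field_hom_rational_function_closure[OF \<Psi>(1) fixes_constants]
    by (simp only: to_fract_eq_var_t)
  then show thesis using that[of \<Psi>] \<Psi> s t by auto
qed

context
  assumes char_2: "CHAR('k::field) = 2"
begin

interpretation additive_quadratic "to_ac var_s :: 'k rfun2 alg_closure" "to_ac var_t"
proof
  have "(var_s :: 'k rfun2) \<noteq> 0" by (simp flip: to_fract_eq_var_s)
  then show "to_ac (var_s :: 'k rfun2) \<noteq> 0" by simp
qed (simp add: char_2)

lemma iter_roots_eq_roots: "iter_roots n = roots n"
  by (simp add: iter_roots_def roots_def poly_frakG_iter)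

lemma base_auto_between_generators:
  assumes "w \<in> generators n" "w' \<in> generators n"
  obtains \<sigma> where "\<sigma> \<in> base_autos" "\<sigma> w = w'"
proof -
  have "poly (map_poly to_ac (L_poly var_s n + [:var_s:])) x = 0" if "x \<in> generators n" for x
    using that by (simp add: hom_distribs to_ac.map_poly_L_poly poly_L_poly generators_def)
  then show thesis
    using base_auto_between_roots[OF irreducible_L_poly_plus_var_s] assms that by metis
qed

lemma base_auto_moves_root:
  assumes "v \<in> roots 1"
  shows "\<exists>\<sigma>\<in>base_autos. \<sigma> v \<noteq> v"
proof -
  have "v + to_ac var_s \<in> roots 1"
    using assms by (simp add: add_in_roots_iff W_def L_eq_0_iff)
  then obtain \<sigma> where "\<sigma> \<in> base_autos" "\<sigma> v = v + to_ac var_s"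
    using base_auto_between_roots[OF irreducible_frakG] assms
    by (auto simp: roots_def poly_frakG)
  then show ?thesis using s_nonzero by (intro bexI[of _ \<sigma>]) auto
qed

lemma base_auto_root_stabilizer_transitive:
  assumes v: "v \<in> roots 1" and w: "w \<in> generators n" "w' \<in> generators n"
  shows "\<exists>\<sigma>\<in>base_autos. \<sigma> v = v \<and> \<sigma> w = w'"
proof -
  let ?s = "to_ac var_s :: 'k rfun2 alg_closure" and ?t = "to_ac var_t :: 'k rfun2 alg_closure"
  obtain \<Psi> :: "'k rfun2 alg_closure \<Rightarrow> 'k rfun2 alg_closure"
    where \<Psi>: "field_hom \<Psi>" "bij \<Psi>" "\<Psi> ` range to_ac \<subseteq> range to_ac" "\<Psi> ?s = ?s" "\<Psi> ?t = L ?s ?t"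
    by (rule isogeny_automorphism)
  interpret field_hom \<Psi> by fact
  have "\<Psi> w \<in> generators n" "\<Psi> w' \<in> generators n"
    using w hom_L_funpow[of n ?s, symmetric] by (simp_all add: generators_def \<Psi>(4))
  then obtain \<tau> where \<tau>: "\<tau> \<in> base_autos" "\<tau> (\<Psi> w) = \<Psi> w'"
    by (rule base_auto_between_generators)
  have "\<Psi> v \<in> range to_ac"
  proof -
    have "L ?s v = ?t" using v by (simp add: roots_def G_def)
    then have "L ?s (\<Psi> v) = L ?s ?t" using hom_L[of ?s v] \<Psi>(4,5) by simp
    then have "L ?s (\<Psi> v + ?t) = 0" by (simp add: L_add)
    then have "\<Psi> v + ?t = 0 \<or> \<Psi> v + ?t = ?s" by (simp only: L_eq_0_iff)
    then have "\<Psi> v = to_ac var_t \<or> \<Psi> v = to_ac (var_s + var_t)"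
      by (metis add_eq_0_iff_eq add.commute add_self_left to_ac_add)
    then show ?thesis by blast
  qed
  then have "\<tau> (\<Psi> v) = \<Psi> v" using \<tau>(1) by (auto simp: base_autos_iff)
  show ?thesis
  proof (intro bexI conjI)
    let ?\<sigma> = "inv_into UNIV \<Psi> \<circ> \<tau> \<circ> \<Psi>"
    show "?\<sigma> \<in> base_autos" using conjugate_base_auto \<Psi> \<tau>(1) by blast
    show "?\<sigma> v = v" "?\<sigma> w = w'"
      using \<open>\<tau> (\<Psi> v) = \<Psi> v\<close> \<tau>(2) \<Psi>(2) by (simp_all add: bij_is_inj)
  qed
qed

lemma quadratic_galois_base_autos:
  "quadratic_galois (to_ac var_s :: 'k rfun2 alg_closure) (to_ac var_t) base_autos"
proof
  fix \<sigma> :: "'k rfun2 alg_closure \<Rightarrow> 'k rfun2 alg_closure" assume \<sigma>: "\<sigma> \<in> base_autos"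
  then interpret field_hom \<sigma> by (simp add: base_autos_iff)
  show "\<sigma> (to_ac var_s) = to_ac var_s" "\<sigma> (to_ac var_t) = to_ac var_t"
    using \<sigma> by (simp_all add: base_autos_iff)
  then show "L_linear \<sigma>" by (simp add: L_linear_def hom_add hom_L)
  show "bij \<sigma>" "inv_into UNIV \<sigma> \<in> base_autos" "\<And>\<tau>. \<tau> \<in> base_autos \<Longrightarrow> \<sigma> \<circ> \<tau> \<in> base_autos"
    using \<sigma> by (rule bij_base_auto, rule inv_into_base_autos, rule comp_base_autos)
qed (use id_base_autos base_auto_moves_root base_auto_root_stabilizer_transitive in blast)+

lemma FPP_Gal_iter_Suc:
  "FPP (Gal_iter (Suc n) :: ('k rfun2 alg_closure \<Rightarrow> 'k rfun2 alg_closure) set) (iter_roots (Suc n))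
    = 1 / 3 + (1 / 4) ^ n / 6"
  unfolding Gal_iter_def iter_roots_eq_roots
  by (rule quadratic_galois.FPP_restrict[OF quadratic_galois_base_autos])

end

theorem theorem5p4:
  assumes "CHAR('k::field) = 2"
  shows "(\<lambda>n. FPP (Gal_iter n :: ('k rfun2 alg_closure \<Rightarrow> 'k rfun2 alg_closure) set)
                  (iter_roots n)) \<longlonglongrightarrow> 1 / 3"
proof (rule LIMSEQ_imp_Suc)
  have "(\<lambda>n. 1 / 3 + (1 / 4) ^ n / 6) \<longlonglongrightarrow> 1 / 3 + 0 / (6 :: real)"
    by (intro tendsto_intros LIMSEQ_power_zero) simp_all
  then show "(\<lambda>n. FPP (Gal_iter (Suc n) :: ('k rfun2 alg_closure \<Rightarrow> 'k rfun2 alg_closure) set)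
      (iter_roots (Suc n))) \<longlonglongrightarrow> 1 / 3"
    by (simp add: FPP_Gal_iter_Suc[OF assms])
qed

end
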